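(* Let $\{b_i\}_{i\in\mathbb N}$ be a sequence of bases with $b_i\in\mathbb N$, $b_i\ge2$, and let $\xi:\mathbb N\to\mathbb N$ be an increasing function. Then, for any given $\varepsilon>0$, for almost every $x=[d_1,\dots,d_n,\dots]\in[0,1)$ (multibase expansion with respect to $\{b_i\}$), $$\#\{1\le n\le N: d_{n+1}=\cdots=d_{n+\xi(n)}=0\}=\Phi(N)+O\Bigl(\Phi^{1/2}(N)\,(\log\Phi(N))^{3/2+\varepsilon}\Bigr),$$ where $\Phi(N):=\sum_{n=1}^N\frac{1}{b_{n+1}\cdots b_{n+1+\xi(n)}}$. In particular, if $D(\xi)$ denotes the set of $x=[d_1,\dots,d_n,\dots]\in[0,1)$ for which $d_{n+1}=d_{n+2}=\cdots=d_{n+\xi(n)}=0$ for infinitely many $n\in\mathbb N$, then $$\lambda(D(\xi))=\begin{cases}0&\text{if }\sum_{n=1}^\infty\frac1{b_n\cdots b_{n+1+\xi(n)}}<\infty,\\1&\text{if }\sum_{n=1}^\infty\frac1{b_n\cdots b_{n+1+\xi(n)}}=\infty.\end{cases}$$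
   Context: $\lambda$ is Lebesgue measure on $[0,1)$. The multibase (Cantor series) expansion of $x\in[0,1)$ with respect to $\{b_i\}$ is the unique expansion $x=\sum_{i=1}^\infty\frac{d_i}{b_1\cdots b_i}$ with $d_i\in\{0,\dots,b_i-1\}$ for which there is no $i_0\in\mathbb N$ with $d_i=b_i-1$ for all $i\ge i_0$; it is written $x=[d_1,\dots,d_n,\dots]$.
   Formalization: The printed weights make the claim false (b_i=2, ξ=1: count ~N/2, not N/4); Φ and the 0-1 series use 1/(b_{n+1}⋯b_{n+ξ(n)}) instead. "Increasing" means non-decreasing, and log Φ(N) is replaced by max(1, log Φ(N)), since its real power is undefined for Φ(N)<1. *)

theory Defs
  imports "HOL-Analysis.Analysis" "HOL-Library.Landau_Symbols"
begin

text \<open>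
  Bases, digits and \<open>\<xi>\<close> are indexed by the positive integers; the values of \<open>b\<close>
  and \<open>\<xi>\<close> at \<open>0\<close> are never used.
\<close>

definition is_multibase_expansion :: "(nat \<Rightarrow> nat) \<Rightarrow> real \<Rightarrow> (nat \<Rightarrow> nat) \<Rightarrow> bool" where
  "is_multibase_expansion b x d \<longleftrightarrow>
     (\<forall>i\<ge>1. d i \<in> {0..b i - 1}) \<and>
     (\<lambda>i. real (d (Suc i)) / real (\<Prod>j=1..Suc i. b j)) sums x \<and>
     \<not> (\<exists>i0\<ge>1. \<forall>i\<ge>i0. d i = b i - 1)"

text \<open>
  The expansion says nothing about \<open>d 0\<close>; it is set to \<open>0\<close> so that the digit
  function is unique.
\<close>

definition multibase_digit :: "(nat \<Rightarrow> nat) \<Rightarrow> real \<Rightarrow> nat \<Rightarrow> nat" where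
  "multibase_digit b x = (THE d. d 0 = 0 \<and> is_multibase_expansion b x d)"

definition zero_block :: "(nat \<Rightarrow> nat) \<Rightarrow> (nat \<Rightarrow> nat) \<Rightarrow> real \<Rightarrow> nat \<Rightarrow> bool" where
  "zero_block b \<xi> x n \<longleftrightarrow> (\<forall>k\<in>{n + 1..n + \<xi> n}. multibase_digit b x k = 0)"

definition zero_block_count :: "(nat \<Rightarrow> nat) \<Rightarrow> (nat \<Rightarrow> nat) \<Rightarrow> real \<Rightarrow> nat \<Rightarrow> nat" where
  "zero_block_count b \<xi> x N = card {n \<in> {1..N}. zero_block b \<xi> x n}"

text \<open>
  The weight of \<open>n\<close> is the Lebesgue measure \<open>1 / (b (n+1) \<cdots> b (n + \<xi> n))\<close> of the
  set of \<open>x\<close> with \<open>d (n+1) = \<dots> = d (n + \<xi> n) = 0\<close>. The source prints the product as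
  \<open>b (n+1) \<cdots> b (n + 1 + \<xi> n)\<close> in the counting function and as
  \<open>b n \<cdots> b (n + 1 + \<xi> n)\<close> in the zero-one law. With these extra factors both
  claims fail: for \<open>b i = 2\<close>, \<open>\<xi> n = 1\<close> the count is asymptotic to \<open>N / 2\<close> almost
  everywhere and not to \<open>N / 4\<close>; for \<open>b i = i + 1\<close>, \<open>\<xi> n = 1\<close> the printed series
  converges, although almost every \<open>x\<close> has infinitely many zero digits.
\<close>

definition block_weight :: "(nat \<Rightarrow> nat) \<Rightarrow> (nat \<Rightarrow> nat) \<Rightarrow> nat \<Rightarrow> real" where
  "block_weight b \<xi> n = 1 / real (\<Prod>k=n + 1..n + \<xi> n. b k)"

definition Phi :: "(nat \<Rightarrow> nat) \<Rightarrow> (nat \<Rightarrow> nat) \<Rightarrow> nat \<Rightarrow> real" where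
  "Phi b \<xi> N = (\<Sum>n=1..N. block_weight b \<xi> n)"

text \<open>
  A real power of \<open>ln (Phi b \<xi> N)\<close> makes no sense while \<open>Phi b \<xi> N < 1\<close>, so the
  logarithm is cut off at \<open>1\<close>. This changes nothing if \<open>Phi b \<xi>\<close> is unbounded, and
  the bound amounts to \<open>O(1)\<close> if \<open>Phi b \<xi>\<close> is bounded.
\<close>

definition Phi_error :: "(nat \<Rightarrow> nat) \<Rightarrow> (nat \<Rightarrow> nat) \<Rightarrow> real \<Rightarrow> nat \<Rightarrow> real" where
  "Phi_error b \<xi> \<epsilon> N =
     Phi b \<xi> N powr (1 / 2) * max 1 (ln (Phi b \<xi> N)) powr (3 / 2 + \<epsilon>)"

definition D_set :: "(nat \<Rightarrow> nat) \<Rightarrow> (nat \<Rightarrow> nat) \<Rightarrow> real set" where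
  "D_set b \<xi> = {x \<in> {0..<1}. \<exists>\<^sub>\<infinity>n. zero_block b \<xi> x n}"

end

theory Submission
  imports Defs "HOL-Probability.Probability_Measure" "HOL-Real_Asymp.Real_Asymp"
begin

text \<open>
  Write \<open>E n\<close> for the event \<open>d (n+1) = \<dots> = d (n + \<xi> n) = 0\<close> and \<open>w n\<close> for its measure. If
  \<open>m \<ge> n + \<xi> n\<close>, then \<open>E n\<close> and \<open>E m\<close> are independent. If \<open>n < m < n + \<xi> n\<close>, then, since \<open>\<xi>\<close> is
  increasing, \<open>E n \<inter> E m\<close> says that the digits from \<open>n + 1\<close> to \<open>m + \<xi> m\<close> vanish, so its measure
  is \<open>w m / (b (n+1) \<cdots> b m) \<le> w m / 2 ^ (m - n)\<close>. Hence the number of \<open>n\<close> in an interval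
  \<open>I\<close> for which \<open>E n\<close> occurs has variance at most \<open>4 \<Sum>n\<in>I. w n\<close>.

  For divergent \<open>\<Sum> w n\<close>, such a variance bound gives the counting asymptotics by the method of
  Rademacher, Menshov, Gal and Koksma: along the times \<open>t j\<close> at which \<open>\<Phi>\<close> first reaches \<open>j\<close>, every
  initial segment of \<open>{..2 ^ r}\<close> is a union of at most \<open>r + 1\<close> dyadic blocks, so by Cauchy--Schwarz
  the sum \<open>X r\<close> of the squared discrepancies over all dyadic blocks controls all squared
  discrepancies up to \<open>t (2 ^ r)\<close>, and \<open>\<Sum>r. X r / (2 ^ r * (r + 1) powr (2 + 2 * \<epsilon>))\<close> has finite
  expectation. For convergent \<open>\<Sum> w n\<close> both claims follow from the Borel--Cantelli lemma.
\<close>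

subsection \<open>Counting asymptotics from a variance bound\<close>

text \<open>The binary expansion of \<open>j\<close> splits the path from \<open>0\<close> to
  \<open>j\<close> into at most one dyadic increment of each length \<open>2 ^ s\<close>, and a
  single increment is at most the Euclidean norm of all increments of its level. The induction peels
  off the last binary digit.\<close>

lemma abs_diff_le_sum_dyadic:
  fixes a :: "nat \<Rightarrow> real"
  assumes "j \<le> 2 ^ r"
  shows "\<bar>a j - a 0\<bar> \<le> (\<Sum>s\<le>r. sqrt (\<Sum>u<2 ^ (r - s). (a (Suc u * 2 ^ s) - a (u * 2 ^ s))\<^sup>2))"
  using assms
proof (induction r arbitrary: a j)
  case 0
  then have "j = 0 \<or> j = 1" by auto
  then show ?case by auto
next
  case (Suc r)
  have step: "\<bar>a i - a k\<bar> \<le> sqrt (\<Sum>u<2 ^ Suc r. (a (Suc u) - a u)\<^sup>2)"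
    if "i = k \<or> (i = Suc k \<and> k < 2 ^ Suc r)" for i k
  proof (cases "i = k")
    case True
    then show ?thesis by (auto intro: sum_nonneg)
  next
    case False
    with that have *: "i = Suc k" "k < 2 ^ Suc r" by auto
    have "(a (Suc k) - a k)\<^sup>2 \<le> (\<Sum>u<2 ^ Suc r. (a (Suc u) - a u)\<^sup>2)"
      by (rule member_le_sum[where f = "\<lambda>u. (a (Suc u) - a u)\<^sup>2"]) (use * in auto)
    then have "sqrt ((a (Suc k) - a k)\<^sup>2) \<le> sqrt (\<Sum>u<2 ^ Suc r. (a (Suc u) - a u)\<^sup>2)"
      by (rule real_sqrt_le_mono)
    then show ?thesis unfolding *(1) real_sqrt_abs .
  qed
  define j' where "j' = j div 2"
  have j: "j = 2 * j' \<or> j = Suc (2 * j')" unfolding j'_def by presburger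
  have "j' \<le> 2 ^ r" using Suc.prems unfolding j'_def by auto
  then have "\<bar>a (2 * j') - a (2 * 0)\<bar> \<le>
      (\<Sum>s\<le>r. sqrt (\<Sum>u<2 ^ (r - s). (a (2 * (Suc u * 2 ^ s)) - a (2 * (u * 2 ^ s)))\<^sup>2))"
    by (rule Suc.IH[where a = "\<lambda>i. a (2 * i)"])
  \<comment> \<open>Level \<open>s\<close> of the sequence at even indices is level
    \<open>s + 1\<close> of \<open>a\<close>; level \<open>0\<close> is left for the possible last
    step from \<open>2 * j'\<close> to \<open>j\<close>.\<close>
  also have "\<dots> = (\<Sum>s\<le>r. sqrt (\<Sum>u<2 ^ (Suc r - Suc s).
      (a (Suc u * 2 ^ Suc s) - a (u * 2 ^ Suc s))\<^sup>2))"
    by (simp add: mult_ac)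
  finally have 1: "\<bar>a (2 * j') - a 0\<bar> \<le> \<dots>" by simp
  have 2: "\<bar>a j - a (2 * j')\<bar> \<le> sqrt (\<Sum>u<2 ^ Suc r. (a (Suc u) - a u)\<^sup>2)"
    by (rule step) (use j Suc.prems in auto)
  show ?case
    unfolding sum.atMost_Suc_shift using 1 2 by simp
qed

text \<open>Cauchy--Schwarz over the \<open>r + 1\<close> levels gives a bound linear in the squared
  increments, so that expectations can be taken term by term.\<close>

lemma square_diff_le_sum_dyadic:
  fixes a :: "nat \<Rightarrow> real"
  assumes "j \<le> 2 ^ r"
  shows "(a j - a 0)\<^sup>2 \<le>
    (real r + 1) * (\<Sum>s\<le>r. \<Sum>u<2 ^ (r - s). (a (Suc u * 2 ^ s) - a (u * 2 ^ s))\<^sup>2)"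
proof -
  define Q where "Q s = (\<Sum>u<2 ^ (r - s). (a (Suc u * 2 ^ s) - a (u * 2 ^ s))\<^sup>2)" for s
  have Q: "Q s \<ge> 0" for s unfolding Q_def by (intro sum_nonneg) auto
  have "(a j - a 0)\<^sup>2 \<le> (\<Sum>s\<le>r. sqrt (Q s))\<^sup>2"
    using abs_diff_le_sum_dyadic[OF assms, of a] unfolding Q_def
    by (subst power2_abs[symmetric], intro power_mono) auto
  also have "\<dots> \<le> (\<Sum>s\<le>r. 1 * sqrt (Q s))\<^sup>2" by simp
  also have "\<dots> \<le> (\<Sum>s\<le>r. 1\<^sup>2) * (\<Sum>s\<le>r. (sqrt (Q s))\<^sup>2)"
    by (rule Cauchy_Schwarz_ineq_sum)
  also have "\<dots> = (real r + 1) * (\<Sum>s\<le>r. Q s)" using Q by simp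
  finally show ?thesis unfolding Q_def .
qed

text \<open>This is the deterministic half of the argument. The hypothesis on \<open>t\<close> says
  that \<open>t j\<close> is the first time at which \<open>\<Phi>\<close> reaches \<open>j\<close>.
  Between \<open>t j\<close> and \<open>t (Suc j)\<close> monotonicity of \<open>F\<close> and
  \<open>\<Phi>\<close> loses only a bounded amount, and a dyadic scale \<open>2 ^ r\<close>
  comparable to \<open>\<Phi> N\<close> has \<open>r\<close> of order
  \<open>ln (\<Phi> N)\<close>.\<close>

lemma bigo_of_dyadic_bound:
  fixes F \<Phi> :: "nat \<Rightarrow> real" and t :: "nat \<Rightarrow> nat"
  assumes "mono F" "mono \<Phi>" "K \<ge> 0" "\<epsilon> > 0"
    and t: "\<And>j N. t j \<le> N \<longleftrightarrow> real j \<le> \<Phi> N"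
    and t_upper: "\<And>j. \<Phi> (t j) \<le> real j + 1"
    and bound: "\<And>j r. j \<le> 2 ^ r \<Longrightarrow>
      (F (t j) - \<Phi> (t j))\<^sup>2 \<le> K * 2 ^ r * (real r + 1) powr (3 + 2 * \<epsilon>)"
  shows "(\<lambda>N. F N - \<Phi> N) \<in> O(\<lambda>N. \<Phi> N powr (1/2) * max 1 (ln (\<Phi> N)) powr (3/2 + \<epsilon>))"
proof -
  \<comment> \<open>The square root of
    \<open>K * (4 * P) * (5 * L) powr (3 + 2 * \<epsilon>)\<close>, the bound at the dyadic scale,
    is \<open>c\<close> times the error term. The additional \<open>2\<close> in
    \<open>c + 2\<close> pays for interpolation.\<close>
  define c where "c = 2 * sqrt K * 5 powr (3/2 + \<epsilon>)"
  have c: "c \<ge> 0" unfolding c_def using assms by auto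
  show ?thesis
  proof (rule bigoI[where c = "c + 2"])
    show "\<forall>\<^sub>F N in sequentially. norm (F N - \<Phi> N) \<le>
      (c + 2) * norm (\<Phi> N powr (1/2) * max 1 (ln (\<Phi> N)) powr (3/2 + \<epsilon>))"
      \<comment> \<open>From \<open>t 1\<close> on, \<open>\<Phi> N \<ge> 1\<close>, so the error
        term is at least \<open>1\<close> and absorbs additive constants.\<close>
      using eventually_ge_at_top[of "t 1"]
    proof eventually_elim
      case (elim N)
      define P where "P = \<Phi> N"
      define L where "L = max 1 (ln P)"
      define E where "E = P powr (1/2) * L powr (3/2 + \<epsilon>)"
      have P: "P \<ge> 1" using elim t[of 1 N] by (simp add: P_def)
      have L: "L \<ge> 1" "ln P \<le> L" unfolding L_def by auto
      have "P powr (1/2) \<ge> 1" using P by (simp add: ge_one_powr_ge_zero)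
      moreover have "L powr (3/2 + \<epsilon>) \<ge> 1" using L assms by (simp add: ge_one_powr_ge_zero)
      ultimately have E: "E \<ge> 1" unfolding E_def using mult_mono[of 1 _ 1] by fastforce
      define j where "j = nat \<lfloor>P\<rfloor>"
      have "real j = of_int \<lfloor>P\<rfloor>" using P by (simp add: j_def)
      then have j': "real j \<le> P" "P < real j + 1" by linarith+
      then have "j \<noteq> 0" using P by (intro notI) simp
      with j' have j: "real j \<le> P" "P < real j + 1" "j \<ge> 1" by simp_all
      \<comment> \<open>The scale is fitted to \<open>j + 1\<close>, since both endpoints
        \<open>t j\<close> and \<open>t (Suc j)\<close> must be covered by the bound for
        \<open>2 ^ r\<close>.\<close>
      from j have "j + 1 \<ge> 2" by simp
      from ex_power_ivl2[OF order_refl this]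
      obtain q where q: "2 ^ q < j + 1" "j + 1 \<le> 2 ^ (q + 1)" by blast
      define r where "r = q + 1"
      have "(2::real) ^ q < real j + 1" using q(1)
        by (simp flip: of_nat_less_iff[where 'a = real])
      then have q': "(2::real) ^ q \<le> 2 * P" using j P by linarith
      then have r1: "(2::real) ^ r \<le> 4 * P" unfolding r_def by simp
      \<comment> \<open>Taking logarithms in \<open>2 ^ q \<le> 2 * P\<close> and using
        \<open>ln 2 \<ge> 1/2\<close> yields \<open>q - 1 \<le> 2 * L\<close>; then
        \<open>r + 1 = q + 2 \<le> 2 * L + 3 \<le> 5 * L\<close>.\<close>
      have "real q * ln 2 = ln (2 ^ q)" by (simp add: ln_realpow)
      also have "\<dots> \<le> ln (2 * P)" using q' P by (subst ln_le_cancel_iff) auto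
      also have "\<dots> = ln 2 + ln P" using P by (simp add: ln_mult)
      finally have "(real q - 1) * ln 2 \<le> ln P" by (simp add: algebra_simps)
      moreover have "(real q - 1) * (1/2) \<le> (real q - 1) * ln 2" if "q \<ge> 1"
        using that ln2_ge_two_thirds by (intro mult_left_mono) linarith+
      ultimately have "(real q - 1) * (1/2) \<le> L" if "q \<ge> 1"
        using L that by force
      then have "real q - 1 \<le> 2 * L" using L by (cases "q \<ge> 1") simp_all
      then have r2: "real r + 1 \<le> 5 * L" using L unfolding r_def by simp
      have "K * 2 ^ r * (real r + 1) powr (3 + 2 * \<epsilon>) \<le> K * (4 * P) * (5 * L) powr (3 + 2 * \<epsilon>)"
        using r1 r2 assms P L by (intro mult_mono powr_mono2) auto
      also have "\<dots> = (c * E)\<^sup>2"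
      proof -
        have "(5 powr (3/2 + \<epsilon>))\<^sup>2 = (5::real) powr (3 + 2 * \<epsilon>)"
          "(L powr (3/2 + \<epsilon>))\<^sup>2 = L powr (3 + 2 * \<epsilon>)" 
          by (simp_all add: power2_eq_square powr_add[symmetric])
        moreover have "(P powr (1/2))\<^sup>2 = P" using P by (simp add: powr_half_sqrt)
        ultimately show ?thesis unfolding c_def E_def using assms L
          by (simp add: power_mult_distrib powr_mult)
      qed
      finally have le: "K * 2 ^ r * (real r + 1) powr (3 + 2 * \<epsilon>) \<le> (c * E)\<^sup>2" .
      have cE: "c * E \<ge> 0" using c E by simp
      have b: "\<bar>F (t i) - \<Phi> (t i)\<bar> \<le> c * E" if "i \<le> 2 ^ r" for i
        using order_trans[OF bound[OF that] le] by (intro power2_le_imp_le[OF _ cE]) simp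
      have "j \<le> 2 ^ r" "Suc j \<le> 2 ^ r" using q(2) unfolding r_def by auto
      note b1 = b[OF this(1)] and b2 = b[OF this(2)]
      have N1: "t j \<le> N" using t[of j N] j P_def by auto
      have N2: "N \<le> t (Suc j)" using t[of "Suc j" N] j P_def by auto
      \<comment> \<open>Above, \<open>\<Phi> (t (Suc j)) \<le> j + 2 \<le> P + 2\<close>; below,
        \<open>\<Phi> (t j) \<ge> j > P - 1\<close>.\<close>
      have "F N - P \<le> F (t (Suc j)) - \<Phi> (t (Suc j)) + 2"
        using monoD[OF assms(1) N2] t_upper[of "Suc j"] j by simp
      moreover have "F N - P \<ge> F (t j) - \<Phi> (t j) - 1"
        using monoD[OF assms(1) N1] t[of j "t j"] j by simp
      ultimately have "\<bar>F N - P\<bar> \<le> c * E + 2" using b1 b2 by linarith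
      also have "\<dots> \<le> (c + 2) * E" using E by (simp add: algebra_simps)
      finally have "\<bar>F N - P\<bar> \<le> (c + 2) * E" .
      then show ?case unfolding P_def[symmetric] L_def[symmetric] E_def[symmetric]
        using E by simp
    qed
  qed
qed

lemma partial_sums_at_top:
  fixes \<phi> :: "nat \<Rightarrow> real"
  assumes "\<And>k. \<phi> k \<ge> 0" "\<not> summable (\<lambda>k. \<phi> (Suc k))"
  shows "filterlim (\<lambda>N. \<Sum>k=1..N. \<phi> k) at_top sequentially"
  unfolding filterlim_at_top
proof
  fix Z :: real
  have "\<exists>N. Z \<le> (\<Sum>k=1..N. \<phi> k)"
  proof (rule ccontr)
    assume "\<nexists>N. Z \<le> (\<Sum>k=1..N. \<phi> k)"
    then have "(\<Sum>k<n. \<phi> (Suc k)) \<le> Z" for n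
      by (simp add: sum.atLeast1_atMost_eq not_le less_imp_le)
    then have "summable (\<lambda>k. \<phi> (Suc k))" by (intro summableI_nonneg_bounded assms)
    with assms show False by simp
  qed
  then obtain N where N: "Z \<le> (\<Sum>k=1..N. \<phi> k)" by blast
  show "\<forall>\<^sub>F N in sequentially. Z \<le> (\<Sum>k=1..N. \<phi> k)"
    using eventually_ge_at_top[of N]
  proof eventually_elim
    case (elim n)
    then have "(\<Sum>k=1..N. \<phi> k) \<le> (\<Sum>k=1..n. \<phi> k)"
      by (intro sum_mono2) (auto simp: assms)
    with N show ?case by simp
  qed
qed

text \<open>The variance bound is additive over intervals, so each of the \<open>r + 1\<close>
  dyadic levels contributes at most \<open>C * \<Phi> (t (2 ^ r))\<close> to the mean of
  \<open>X r\<close>, whatever its block length. The exponent \<open>3 + 2 * \<epsilon>\<close>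
  collects one factor \<open>r + 1\<close> from the number of levels, one from Cauchy--Schwarz, and
  \<open>1 + 2 * \<epsilon>\<close> for summability over \<open>r\<close>; the square root halves
  it.\<close>

lemma AE_sum_asymp_of_variance_bound:
  fixes f :: "nat \<Rightarrow> 'a \<Rightarrow> real" and \<phi> :: "nat \<Rightarrow> real"
  assumes meas [measurable]: "\<And>k. f k \<in> borel_measurable M"
    and f_nonneg: "\<And>k x. f k x \<ge> 0"
    and \<phi>: "\<And>k. 0 \<le> \<phi> k" "\<And>k. \<phi> k \<le> 1"
    and unbounded: "\<not> summable (\<lambda>k. \<phi> (Suc k))"
    and "C \<ge> 0" "\<epsilon> > 0"
    and var: "\<And>m n. m \<le> n \<Longrightarrow>
      (\<integral>\<^sup>+x. ennreal ((\<Sum>k\<in>{m<..n}. f k x - \<phi> k)\<^sup>2) \<partial>M) \<le> ennreal (C * (\<Sum>k\<in>{m<..n}. \<phi> k))"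
  defines "\<Phi> \<equiv> \<lambda>N. \<Sum>k=1..N. \<phi> k"
  shows "AE x in M. (\<lambda>N. (\<Sum>k=1..N. f k x) - \<Phi> N)
    \<in> O(\<lambda>N. \<Phi> N powr (1/2) * max 1 (ln (\<Phi> N)) powr (3/2 + \<epsilon>))"
proof -
  have split_sum: "(\<Sum>k\<in>{m<..n}. g k) = (\<Sum>k=1..n. g k) - (\<Sum>k=1..m. g k)" if "m \<le> n"
    for m n and g :: "nat \<Rightarrow> real"
  proof -
    have "{1..n} = {1..m} \<union> {m<..n}" using that by auto
    then have "(\<Sum>k=1..n. g k) = (\<Sum>k=1..m. g k) + (\<Sum>k\<in>{m<..n}. g k)"
      by (simp only:) (rule sum.union_disjoint, auto)
    then show ?thesis by simp
  qed
  have mono_\<Phi>: "mono \<Phi>" unfolding \<Phi>_def by (intro monoI sum_mono2) (auto simp: \<phi>)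
  have "\<exists>N. real j \<le> \<Phi> N" for j
    using filterlim_at_top[THEN iffD1, OF partial_sums_at_top[OF \<phi>(1) unbounded], rule_format, of "real j"]
    unfolding \<Phi>_def eventually_sequentially by blast
  define t where "t j = (LEAST N. real j \<le> \<Phi> N)" for j :: nat
  have t1: "real j \<le> \<Phi> (t j)" for j
    unfolding t_def using \<open>\<And>j. \<exists>N. real j \<le> \<Phi> N\<close> by (rule LeastI_ex)
  have t: "t j \<le> N \<longleftrightarrow> real j \<le> \<Phi> N" for j N
  proof
    assume "t j \<le> N"
    then show "real j \<le> \<Phi> N" using t1[of j] monoD[OF mono_\<Phi>] by fastforce
  next
    assume "real j \<le> \<Phi> N"
    then show "t j \<le> N" unfolding t_def by (rule Least_le)
  qed
  \<comment> \<open>Each step of \<open>\<Phi>\<close> is at most \<open>1\<close>, so the level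
    \<open>j\<close> is overshot by at most \<open>1\<close>.\<close>
  have t_upper: "\<Phi> (t j) \<le> real j + 1" for j
  proof (cases "t j")
    case 0
    then show ?thesis by (simp add: \<Phi>_def)
  next
    case (Suc N)
    then have "\<Phi> N < real j" using t[of j N] by simp
    then show ?thesis using \<phi>(2)[of "Suc N"] unfolding Suc by (simp add: \<Phi>_def)
  qed
  have t_mono: "t i \<le> t j" if "i \<le> j" for i j
    using that t[of i "t j"] t1[of j] by simp
  have t0: "t 0 = 0" using t[of 0 0] by (simp add: \<Phi>_def)
  define a where "a x j = (\<Sum>k=1..t j. f k x - \<phi> k)" for x j
  define X where "X r x = (\<Sum>s\<le>r. \<Sum>u<2 ^ (r - s). (a x (Suc u * 2 ^ s) - a x (u * 2 ^ s))\<^sup>2)"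
    for r :: nat and x
  \<comment> \<open>This exceeds the order \<open>(r + 1) * 2 ^ r\<close> of the mean of
    \<open>X r\<close> by the factor \<open>(r + 1) powr (1 + 2 * \<epsilon>)\<close>, which makes
    the normalized means summable.\<close>
  define c where "c r = 2 ^ r * (real r + 1) powr (2 + 2 * \<epsilon>)" for r :: nat
  have c: "c r > 0" for r unfolding c_def by simp
  have X0: "X r x \<ge> 0" for r x unfolding X_def by (intro sum_nonneg) auto
  have [measurable]: "(\<lambda>x. a x j) \<in> borel_measurable M" for j unfolding a_def by measurable
  have [measurable]: "X r \<in> borel_measurable M" for r unfolding X_def by measurable
  have incr: "(\<integral>\<^sup>+x. ennreal ((a x j - a x i)\<^sup>2) \<partial>M) \<le> ennreal (C * (\<Phi> (t j) - \<Phi> (t i)))"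
    if "i \<le> j" for i j
    using var[OF t_mono[OF that]] unfolding a_def \<Phi>_def by (simp only: split_sum[OF t_mono[OF that]])
  have EX: "(\<integral>\<^sup>+x. ennreal (X r x) \<partial>M) \<le> ennreal (2 * C * (real r + 1) * 2 ^ r)" for r
  proof -
    have "(\<integral>\<^sup>+x. ennreal (X r x) \<partial>M) = (\<Sum>s\<le>r. \<Sum>u<2 ^ (r - s).
        \<integral>\<^sup>+x. ennreal ((a x (Suc u * 2 ^ s) - a x (u * 2 ^ s))\<^sup>2) \<partial>M)"
    proof -
      have "ennreal (X r x) = (\<Sum>s\<le>r. \<Sum>u<2 ^ (r - s).
          ennreal ((a x (Suc u * 2 ^ s) - a x (u * 2 ^ s))\<^sup>2))" for x
        unfolding X_def
        by (subst sum_ennreal[symmetric], rule sum_nonneg, simp, intro sum.cong refl sum_ennreal[symmetric], simp)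
      then show ?thesis by (simp only: nn_integral_sum borel_measurable_sum sum_nonneg) (subst nn_integral_sum, measurable, intro sum.cong refl nn_integral_sum, measurable)
    qed
    also have "\<dots> \<le> (\<Sum>s\<le>r. \<Sum>u<2 ^ (r - s). ennreal (C * (\<Phi> (t (Suc u * 2 ^ s)) - \<Phi> (t (u * 2 ^ s)))))"
      by (intro sum_mono incr) auto
    also have "\<dots> = (\<Sum>s\<le>r. ennreal (\<Sum>u<2 ^ (r - s). C * (\<Phi> (t (Suc u * 2 ^ s)) - \<Phi> (t (u * 2 ^ s)))))"
      using \<open>C \<ge> 0\<close>
      by (intro sum.cong refl sum_ennreal) (auto intro!: mult_nonneg_nonneg t_mono monoD[OF mono_\<Phi>])
    \<comment> \<open>On each level the increments of \<open>\<Phi>\<close> telescope, starting from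
      \<open>\<Phi> (t 0) = 0\<close>.\<close>
    also have "\<dots> = (\<Sum>s\<le>r. ennreal (C * \<Phi> (t (2 ^ r))))"
    proof (intro sum.cong refl arg_cong[where f = ennreal])
      fix s assume "s \<in> {..r}"
      then have p: "2 ^ (r - s) * 2 ^ s = (2::nat) ^ r" by (simp flip: power_add)
      have "(\<Sum>u<2 ^ (r - s). \<Phi> (t (Suc u * 2 ^ s)) - \<Phi> (t (u * 2 ^ s)))
          = \<Phi> (t (2 ^ (r - s) * 2 ^ s)) - \<Phi> (t (0 * 2 ^ s))"
        by (rule sum_lessThan_telescope)
      also have "\<dots> = \<Phi> (t (2 ^ r))" unfolding p using t0 by (simp add: \<Phi>_def)
      finally show "(\<Sum>u<2 ^ (r - s). C * (\<Phi> (t (Suc u * 2 ^ s)) - \<Phi> (t (u * 2 ^ s)))) = C * \<Phi> (t (2 ^ r))"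
        by (simp flip: sum_distrib_left)
    qed
    also have "\<dots> = ennreal ((real r + 1) * (C * \<Phi> (t (2 ^ r))))"
      using \<open>C \<ge> 0\<close> by (subst sum_ennreal) (auto simp: \<Phi>_def \<phi> add.commute intro!: sum_nonneg mult_nonneg_nonneg)
    also have "\<dots> \<le> ennreal ((real r + 1) * (C * (2 * 2 ^ r)))"
    proof -
      have "\<Phi> (t (2 ^ r)) \<le> 2 ^ r + 1" using t_upper[of "2 ^ r"] by simp
      also have "\<dots> \<le> 2 * 2 ^ r" using one_le_power[of "2::real" r] by simp
      finally show ?thesis using \<open>C \<ge> 0\<close> by (intro ennreal_leI mult_left_mono) auto
    qed
    also have "(real r + 1) * (C * (2 * 2 ^ r)) = 2 * C * (real r + 1) * 2 ^ r"
      by (simp only: mult_ac)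
    finally show ?thesis .
  qed
  have "(\<integral>\<^sup>+x. (\<Sum>r. ennreal (X r x / c r)) \<partial>M) = (\<Sum>r. \<integral>\<^sup>+x. ennreal (X r x / c r) \<partial>M)"
    by (intro nn_integral_suminf) measurable
  also have "\<dots> \<le> (\<Sum>r. ennreal (2 * C * (real r + 1) powr (- 1 - 2 * \<epsilon>)))"
  proof (intro suminf_le summableI)
    fix r
    have "(\<integral>\<^sup>+x. ennreal (X r x / c r) \<partial>M) = (\<integral>\<^sup>+x. ennreal (1 / c r) * ennreal (X r x) \<partial>M)"
      using c[of r] X0 by (intro nn_integral_cong) (simp flip: ennreal_mult')
    also have "\<dots> = ennreal (1 / c r) * (\<integral>\<^sup>+x. ennreal (X r x) \<partial>M)"
      by (rule nn_integral_cmult) measurable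
    also have "\<dots> \<le> ennreal (1 / c r) * ennreal (2 * C * (real r + 1) * 2 ^ r)"
      by (intro mult_left_mono EX) auto
    also have "\<dots> = ennreal (1 / c r * (2 * C * (real r + 1) * 2 ^ r))"
      using c[of r] by (intro ennreal_mult'[symmetric]) simp
    also have "1 / c r * (2 * C * (real r + 1) * 2 ^ r) = 2 * C * (real r + 1) powr (- 1 - 2 * \<epsilon>)"
    proof -
      have "(real r + 1) powr (- 1 - 2 * \<epsilon>) = (real r + 1) powr (1 - (2 + 2 * \<epsilon>))" by simp
      also have "\<dots> = (real r + 1) / (real r + 1) powr (2 + 2 * \<epsilon>)"
        by (subst powr_diff) simp
      finally show ?thesis by (simp add: c_def)
    qed
    finally show "(\<integral>\<^sup>+x. ennreal (X r x / c r) \<partial>M) \<le> ennreal (2 * C * (real r + 1) powr (- 1 - 2 * \<epsilon>))" .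
  qed
  also have "\<dots> < \<infinity>"
  proof -
    have "summable (\<lambda>r. real (Suc r) powr (- 1 - 2 * \<epsilon>))"
      using \<open>\<epsilon> > 0\<close> by (subst summable_Suc_iff) (simp add: summable_real_powr_iff)
    then have "summable (\<lambda>r. 2 * C * (real r + 1) powr (- 1 - 2 * \<epsilon>))"
      by (intro summable_mult) (simp add: add.commute)
    then show ?thesis using \<open>C \<ge> 0\<close> by (subst suminf_ennreal2) auto
  qed
  finally have "(\<integral>\<^sup>+x. (\<Sum>r. ennreal (X r x / c r)) \<partial>M) \<noteq> \<infinity>" by simp
  then have "AE x in M. (\<Sum>r. ennreal (X r x / c r)) \<noteq> \<infinity>"
    by (intro nn_integral_PInf_AE) measurable
  then show ?thesis
  proof eventually_elim
    case (elim x)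
    \<comment> \<open>The finite sum \<open>Y\<close> dominates each of its terms and serves as the
      constant \<open>K\<close>, which may depend on \<open>x\<close>.\<close>
    then obtain Y where Y: "(\<Sum>r. ennreal (X r x / c r)) = ennreal Y" "Y \<ge> 0"
      by (cases "\<Sum>r. ennreal (X r x / c r)") auto
    have XY: "X r x \<le> Y * c r" for r
    proof -
      have "ennreal (X r x / c r) \<le> (\<Sum>r. ennreal (X r x / c r))"
        using sum_le_suminf[of "\<lambda>r. ennreal (X r x / c r)" "{r}"] by (simp add: summableI)
      then have "X r x / c r \<le> Y" unfolding Y(1) using Y(2) by (simp add: ennreal_le_iff)
      then show ?thesis using c[of r] by (simp add: divide_simps)
    qed
    show ?case
    proof (rule bigo_of_dyadic_bound[OF _ mono_\<Phi> Y(2) \<open>\<epsilon> > 0\<close> t t_upper])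
      show "mono (\<lambda>N. \<Sum>k=1..N. f k x)" by (intro monoI sum_mono2) (auto simp: f_nonneg)
      fix j r :: nat assume "j \<le> 2 ^ r"
      have "((\<Sum>k=1..t j. f k x) - \<Phi> (t j))\<^sup>2 = (a x j - a x 0)\<^sup>2"
        by (simp add: a_def \<Phi>_def t0 sum_subtractf)
      also have "\<dots> \<le> (real r + 1) * X r x"
        unfolding X_def by (rule square_diff_le_sum_dyadic) fact
      also have "\<dots> \<le> (real r + 1) * (Y * c r)" using XY by (intro mult_left_mono) auto
      also have "\<dots> = Y * 2 ^ r * ((real r + 1) powr 1 * (real r + 1) powr (2 + 2 * \<epsilon>))"
        by (simp add: c_def)
      also have "\<dots> = Y * 2 ^ r * (real r + 1) powr (3 + 2 * \<epsilon>)"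
        by (subst powr_add[symmetric]) simp
      finally show "((\<Sum>k=1..t j. f k x) - \<Phi> (t j))\<^sup>2 \<le> Y * 2 ^ r * (real r + 1) powr (3 + 2 * \<epsilon>)" .
    qed
  qed
qed

text \<open>The covariance of a pair is charged to its later event \<open>E j\<close>. The geometric
  decay in the distance leaves a total of at most \<open>2 * prob (E j)\<close>, and the two orders
  of a pair double this.\<close>

lemma (in prob_space) variance_sum_indicator_le:
  assumes [measurable]: "\<And>k. E k \<in> events" and "finite I"
    and corr: "\<And>i j. i \<in> I \<Longrightarrow> j \<in> I \<Longrightarrow> i < j \<Longrightarrow>
      prob (E i \<inter> E j) \<le> prob (E i) * prob (E j) + prob (E j) / 2 ^ (j - i)"
  shows "(\<integral>\<^sup>+x. ennreal ((\<Sum>k\<in>I. indicator (E k) x - prob (E k))\<^sup>2) \<partial>M)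
    \<le> ennreal (4 * (\<Sum>k\<in>I. prob (E k)))"
proof -
  define g where "g k x = (indicator (E k) x - prob (E k) :: real)" for k x
  have ind [simp]: "integrable M (indicator (E i) :: _ \<Rightarrow> real)" for i
    by (simp add: emeasure_eq_measure)
  have ind2 [simp]: "integrable M (\<lambda>x. indicator (E i) x * indicator (E j) x :: real)" for i j
  proof -
    have "integrable M (indicator (E i \<inter> E j) :: _ \<Rightarrow> real)"
      by (simp add: emeasure_eq_measure)
    then show ?thesis by (simp add: indicator_inter_arith[abs_def])
  qed
  have int: "integrable M (\<lambda>x. g i x * g j x)"
    and int_eq: "(\<integral>x. g i x * g j x \<partial>M) = prob (E i \<inter> E j) - prob (E i) * prob (E j)" for i j
  proof -
    have eq: "g i x * g j x = indicator (E i) x * indicator (E j) x - prob (E j) * indicator (E i) x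
        - prob (E i) * indicator (E j) x + prob (E i) * prob (E j)" for x
      by (simp add: g_def algebra_simps)
    show "integrable M (\<lambda>x. g i x * g j x)" unfolding eq by simp
    have "(\<integral>x. indicator (E i) x * indicator (E j) x \<partial>M) = prob (E i \<inter> E j)"
      by (simp flip: indicator_inter_arith)
    then show "(\<integral>x. g i x * g j x \<partial>M) = prob (E i \<inter> E j) - prob (E i) * prob (E j)"
      unfolding eq by (simp add: prob_space)
  qed
  \<comment> \<open>Including the diagonal lets \<open>h i j + h j i\<close> bound the covariance
    uniformly, variances as well as pairs in either order.\<close>
  define h where "h i j = (if i \<le> j then prob (E j) * (1/2) ^ (j - i) else 0)" for i j
  have h: "prob (E i \<inter> E j) - prob (E i) * prob (E j) \<le> h i j + h j i"
    if "i \<in> I" "j \<in> I" for i j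
  proof (cases i j rule: linorder_cases)
    case less
    then show ?thesis using corr[OF that] by (simp add: h_def power_one_over field_simps)
  next
    case equal
    have "- (prob (E j) * prob (E j)) \<le> 0" by simp
    also have "0 \<le> prob (E j)" by simp
    finally show ?thesis using equal by (simp add: h_def)
  next
    case greater
    then show ?thesis using corr[OF that(2,1)]
      by (simp add: h_def power_one_over field_simps Int_commute)
  qed
  have h_sum: "(\<Sum>i\<in>I. h i j) \<le> 2 * prob (E j)" for j
  proof -
    have "(\<Sum>i\<in>I. h i j) = (\<Sum>i\<in>I \<inter> {..j}. prob (E j) * (1/2) ^ (j - i))"
      unfolding h_def using \<open>finite I\<close> by (subst sum.inter_restrict) auto
    also have "\<dots> \<le> (\<Sum>i\<le>j. prob (E j) * (1/2) ^ (j - i))"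
      by (intro sum_mono2) auto
    also have "\<dots> = prob (E j) * (\<Sum>i\<le>j. (1/2) ^ (j - i))" by (simp add: sum_distrib_left)
    also have "\<dots> \<le> prob (E j) * 2"
    proof (intro mult_left_mono)
      have "(\<Sum>i\<le>j. (1/2) ^ (j - i)) = (\<Sum>i\<le>j. (1/2::real) ^ i)"
        by (rule sum.nat_diff_reindex[of "\<lambda>i. (1/2) ^ i" "Suc j", unfolded lessThan_Suc_atMost, simplified])
      also have "\<dots> \<le> 2"
        unfolding lessThan_Suc_atMost[symmetric] by (subst geometric_sum) auto
      finally show "(\<Sum>i\<le>j. (1/2::real) ^ (j - i)) \<le> 2" .
    qed simp
    finally show ?thesis by (simp add: mult.commute)
  qed
  have "(\<integral>\<^sup>+x. ennreal ((\<Sum>k\<in>I. g k x)\<^sup>2) \<partial>M) = (\<integral>\<^sup>+x. ennreal (\<Sum>i\<in>I. \<Sum>j\<in>I. g i x * g j x) \<partial>M)"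
    by (simp add: power2_eq_square sum_product)
  also have "\<dots> = ennreal (\<integral>x. (\<Sum>i\<in>I. \<Sum>j\<in>I. g i x * g j x) \<partial>M)"
  proof (rule nn_integral_eq_integral)
    show "integrable M (\<lambda>x. \<Sum>i\<in>I. \<Sum>j\<in>I. g i x * g j x)"
      by (intro Bochner_Integration.integrable_sum int)
    show "AE x in M. 0 \<le> (\<Sum>i\<in>I. \<Sum>j\<in>I. g i x * g j x)"
      by (simp flip: sum_product power2_eq_square)
  qed
  also have "(\<integral>x. (\<Sum>i\<in>I. \<Sum>j\<in>I. g i x * g j x) \<partial>M)
      = (\<Sum>i\<in>I. \<Sum>j\<in>I. prob (E i \<inter> E j) - prob (E i) * prob (E j))"
    by (simp add: Bochner_Integration.integral_sum int int_eq)
  also have "\<dots> \<le> (\<Sum>i\<in>I. \<Sum>j\<in>I. h i j + h j i)"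
    by (intro sum_mono h)
  also have "\<dots> = 2 * (\<Sum>j\<in>I. \<Sum>i\<in>I. h i j)"
    using sum.swap[of h I I] by (simp add: sum.distrib)
  also have "\<dots> \<le> 2 * (\<Sum>j\<in>I. 2 * prob (E j))"
    by (intro mult_left_mono sum_mono h_sum) auto
  also have "\<dots> = 4 * (\<Sum>j\<in>I. prob (E j))" by (simp add: sum_distrib_left)
  finally show ?thesis unfolding g_def by (simp add: ennreal_leI)
qed

subsection \<open>Digits of Cantor series\<close>

text \<open>The set is a disjoint union of intervals of length \<open>t / K\<close>, one at the left
  end of each selected cell. For \<open>K = b 1 * ... * b n\<close> the floor records the first
  \<open>n\<close> digits and the fractional part the remaining ones, so the product form of the
  measure is their independence.\<close>

lemma measure_floor_frac:
  fixes K :: nat and J :: "int set"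
  assumes "K > 0" "0 \<le> t" "t \<le> 1"
  defines "S \<equiv> {x \<in> {0..<1}. \<lfloor>real K * x\<rfloor> \<in> J \<and> frac (real K * x) < t}"
  shows "S \<in> sets borel" "measure lborel S = real (card (J \<inter> {0..<int K})) * t / real K"
proof -
  define I where "I j = {real_of_int j / real K ..< (real_of_int j + t) / real K}" for j :: int
  have I_iff: "x \<in> I j \<longleftrightarrow> \<lfloor>real K * x\<rfloor> = j \<and> frac (real K * x) < t" for x j
  proof -
    have "x \<in> I j \<longleftrightarrow> real_of_int j \<le> real K * x \<and> real K * x < real_of_int j + t"
      using assms(1) by (simp add: I_def field_simps)
    also have "\<dots> \<longleftrightarrow> \<lfloor>real K * x\<rfloor> = j \<and> frac (real K * x) < t"
    proof (cases "\<lfloor>real K * x\<rfloor> = j")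
      case True
      then show ?thesis unfolding frac_def by linarith
    next
      case False
      then have "\<not> (real_of_int j \<le> real K * x \<and> real K * x < real_of_int j + 1)"
        by (simp add: floor_eq_iff)
      \<comment> \<open>Because \<open>t \<le> 1\<close>, the interval from \<open>j\<close> to
        \<open>j + t\<close> does not leave the cell of \<open>j\<close>.\<close>
      with False assms(3) show ?thesis by linarith
    qed
    finally show ?thesis .
  qed
  have unit: "x \<in> {0..<1} \<longleftrightarrow> \<lfloor>real K * x\<rfloor> \<in> {0..<int K}" for x :: real
  proof -
    have "x \<in> {0..<1} \<longleftrightarrow> 0 \<le> real K * x \<and> real K * x < real K * 1"
      using assms(1) by (simp only: mult_less_cancel_left_pos of_nat_0_less_iff zero_le_mult_iff) auto
    also have "\<dots> \<longleftrightarrow> \<lfloor>real K * x\<rfloor> \<in> {0..<int K}"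
      by (simp add: le_floor_iff floor_less_iff)
    finally show ?thesis .
  qed
  have S: "S = (\<Union>j\<in>J \<inter> {0..<int K}. I j)"
  proof (intro set_eqI iffI)
    fix x assume "x \<in> S"
    then show "x \<in> (\<Union>j\<in>J \<inter> {0..<int K}. I j)"
      using unit[of x] I_iff[of x "\<lfloor>real K * x\<rfloor>"] by (auto simp: S_def)
  next
    fix x assume "x \<in> (\<Union>j\<in>J \<inter> {0..<int K}. I j)"
    then obtain j where "j \<in> J" "j \<in> {0..<int K}" "x \<in> I j" by blast
    then show "x \<in> S" using unit[of x] I_iff[of x j] by (simp add: S_def)
  qed
  show "S \<in> sets borel" unfolding S I_def by (intro sets.finite_UN) auto
  have "measure lborel S = (\<Sum>j\<in>J \<inter> {0..<int K}. measure lborel (I j))"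
    unfolding S
  proof (rule measure_finite_Union)
    show "disjoint_family_on I (J \<inter> {0..<int K})"
      by (auto simp: disjoint_family_on_def I_iff)
    show "emeasure lborel (I i) \<noteq> \<infinity>" for i
      using assms by (simp add: I_def divide_right_mono)
  qed (auto simp: I_def)
  also have "\<dots> = (\<Sum>j\<in>J \<inter> {0..<int K}. t / real K)"
    using assms by (intro sum.cong refl) (simp add: I_def add_divide_distrib divide_right_mono)
  finally show "measure lborel S = real (card (J \<inter> {0..<int K})) * t / real K" by simp
qed

locale multibase =
  fixes b :: "nat \<Rightarrow> nat"
  assumes base_ge_2: "i \<ge> 1 \<Longrightarrow> b i \<ge> 2"
begin

definition block_prod :: "nat \<Rightarrow> nat \<Rightarrow> nat" where
  "block_prod p q = (\<Prod>k=p+1..q. b k)"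

abbreviation scale :: "nat \<Rightarrow> nat" where
  "scale n \<equiv> block_prod 0 n"

lemma block_prod_self [simp]: "block_prod p p = 1"
  by (simp add: block_prod_def)

lemma block_prod_Suc: "p \<le> q \<Longrightarrow> block_prod p (Suc q) = block_prod p q * b (Suc q)"
  by (simp add: block_prod_def)

lemma block_prod_pos [simp]: "block_prod p q > 0"
  unfolding block_prod_def
proof (rule prod_pos)
  show "0 < b k" if "k \<in> {p + 1..q}" for k using base_ge_2[of k] that by simp
qed

lemma block_prod_mult:
  assumes "p \<le> q" "q \<le> r"
  shows "block_prod p q * block_prod q r = block_prod p r"
  using assms(2,1) by (induction r rule: dec_induct) (auto simp: block_prod_Suc mult_ac)

lemma block_prod_ge: "p \<le> q \<Longrightarrow> 2 ^ (q - p) \<le> block_prod p q"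
proof (induction q rule: dec_induct)
  case (step q)
  then have "2 ^ (q - p) * 2 \<le> block_prod p q * b (Suc q)"
    using base_ge_2[of "Suc q"] by (intro mult_mono) auto
  with step show ?case by (simp add: block_prod_Suc Suc_diff_le)
qed simp

text \<open>For \<open>x\<close> in the unit interval this is the integer written in mixed radix by
  the first \<open>n\<close> digits of \<open>x\<close>.\<close>

definition prefix :: "real \<Rightarrow> nat \<Rightarrow> int" where
  "prefix x n = \<lfloor>real (scale n) * x\<rfloor>"

definition digit :: "real \<Rightarrow> nat \<Rightarrow> nat" where
  "digit x n = (if n = 0 then 0 else nat (prefix x n - int (b n) * prefix x (n - 1)))"

lemma prefix_Suc_bounds:
  "int (b (Suc n)) * prefix x n \<le> prefix x (Suc n)"
  "prefix x (Suc n) < int (b (Suc n)) * (prefix x n + 1)"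
proof -
  define y where "y = real (scale n) * x"
  have b: "real (b (Suc n)) > 0" using base_ge_2[of "Suc n"] by simp
  have 1: "prefix x (Suc n) = \<lfloor>real (b (Suc n)) * y\<rfloor>"
    by (simp add: prefix_def block_prod_Suc y_def mult_ac)
  have "real (b (Suc n)) * real_of_int (prefix x n) \<le> real (b (Suc n)) * y"
    unfolding prefix_def y_def by (intro mult_left_mono) auto
  then show "int (b (Suc n)) * prefix x n \<le> prefix x (Suc n)"
    unfolding 1 le_floor_iff by simp
  have "y < real_of_int (prefix x n + 1)" unfolding prefix_def y_def by linarith
  then have "real (b (Suc n)) * y < real (b (Suc n)) * real_of_int (prefix x n + 1)"
    using b by (intro mult_strict_left_mono)
  then show "prefix x (Suc n) < int (b (Suc n)) * (prefix x n + 1)"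
    unfolding 1 floor_less_iff by simp
qed

lemma prefix_Suc: "prefix x (Suc n) = int (b (Suc n)) * prefix x n + int (digit x (Suc n))"
  using prefix_Suc_bounds(1)[of n x] by (simp add: digit_def)

lemma digit_less: "digit x (Suc n) < b (Suc n)"
  using prefix_Suc_bounds(2)[of x n] unfolding prefix_Suc by (simp add: algebra_simps)

lemma scale_pos: "real (scale n) > 0"
  by simp

text \<open>Horner's scheme: \<open>s n\<close> is the numerator of the partial sum over the common
  denominator. It serves both existence, with \<open>s = prefix x\<close>, and uniqueness.\<close>

lemma sum_digits_eq_of_recurrence:
  assumes "s 0 = (0::int)" "\<And>n. s (Suc n) = int (b (Suc n)) * s n + int (d (Suc n))"
  shows "(\<Sum>i<n. real (d (Suc i)) / real (scale (Suc i))) = real_of_int (s n) / real (scale n)"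
proof (induction n)
  case 0
  then show ?case using assms by simp
next
  case (Suc n)
  have "real (b (Suc n)) > 0" using base_ge_2[of "Suc n"] by simp
  then show ?case unfolding sum.lessThan_Suc Suc.IH assms(2)
    using scale_pos[of n] by (simp add: block_prod_Suc field_simps)
qed

lemma prefix_0: "x \<in> {0..<1} \<Longrightarrow> prefix x 0 = 0"
  by (simp add: prefix_def floor_eq_iff)

lemma scale_at_top: "filterlim (\<lambda>n. real (scale n)) at_top sequentially"
proof (rule filterlim_at_top_mono)
  show "filterlim (\<lambda>n. 2 ^ n :: real) at_top sequentially"
    by real_asymp
  show "\<forall>\<^sub>F n in sequentially. 2 ^ n \<le> real (scale n)"
  proof (intro always_eventually allI)
    fix n
    have "real (2 ^ n) \<le> real (scale n)" using block_prod_ge[of 0 n] by (intro of_nat_mono) simp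
    then show "2 ^ n \<le> real (scale n)" by simp
  qed
qed

lemma inverse_scale_tendsto_0: "(\<lambda>n. 1 / real (scale n)) \<longlonglongrightarrow> 0"
  by (rule tendsto_divide_0[OF tendsto_const])
     (rule filterlim_at_top_imp_at_infinity, rule scale_at_top)

lemma prefix_div_scale: "(\<lambda>n. real_of_int (prefix x n) / real (scale n)) \<longlonglongrightarrow> x"
proof -
  have "norm (real_of_int (prefix x n) / real (scale n) - x) \<le> 1 / real (scale n)" for n
  proof -
    have "\<bar>real_of_int (prefix x n) - real (scale n) * x\<bar> \<le> 1"
      unfolding prefix_def by linarith
    then have "\<bar>real_of_int (prefix x n) - real (scale n) * x\<bar> / real (scale n) \<le> 1 / real (scale n)"
      by (intro divide_right_mono) auto
    moreover have "real_of_int (prefix x n) / real (scale n) - x =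
        (real_of_int (prefix x n) - real (scale n) * x) / real (scale n)"
      unfolding diff_divide_distrib by simp
    ultimately show ?thesis by (simp only: real_norm_def abs_divide abs_of_nat)
  qed
  then have "(\<lambda>n. real_of_int (prefix x n) / real (scale n) - x) \<longlonglongrightarrow> 0"
    by (intro Lim_null_comparison[OF _ inverse_scale_tendsto_0] always_eventually) simp
  then show ?thesis by (simp add: LIM_zero_iff)
qed

lemma scale_eq: "(\<Prod>j=1..i. b j) = scale i"
  by (simp add: block_prod_def)

lemma is_multibase_expansion_digit:
  assumes "x \<in> {0..<1}"
  shows "is_multibase_expansion b x (digit x)"
  unfolding is_multibase_expansion_def scale_eq
proof (intro conjI allI impI)
  fix i :: nat assume "1 \<le> i"
  then obtain n where "i = Suc n" by (cases i) auto
  then show "digit x i \<in> {0..b i - 1}" using digit_less[of x n] by simp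
next
  show "(\<lambda>i. real (digit x (Suc i)) / real (scale (Suc i))) sums x"
    unfolding sums_def using prefix_div_scale[of x]
    by (subst sum_digits_eq_of_recurrence[of "prefix x"]) (use prefix_0[OF assms] prefix_Suc in auto)
next
  show "\<not> (\<exists>i0\<ge>1. \<forall>i\<ge>i0. digit x i = b i - 1)"
  proof
    assume "\<exists>i0\<ge>1. \<forall>i\<ge>i0. digit x i = b i - 1"
    then obtain i0 where i0: "i0 \<ge> 1" "\<And>i. i \<ge> i0 \<Longrightarrow> digit x i = b i - 1" by blast
    \<comment> \<open>Maximal digits from \<open>i0\<close> on would fix the right endpoint
      \<open>c\<close> of the cell of \<open>x\<close>. The endpoints tend to \<open>x\<close>,
      which would force \<open>x = c\<close>, although cells are open on the right.\<close>
    define c where "c = (real_of_int (prefix x i0) + 1) / real (scale i0)"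
    have c: "(real_of_int (prefix x n) + 1) / real (scale n) = c" if "n \<ge> i0" for n
      using that
    proof (induction n rule: dec_induct)
      case base
      then show ?case by (simp add: c_def)
    next
      case (step n)
      have b: "b (Suc n) \<ge> 2" using base_ge_2[of "Suc n"] by simp
      have "real_of_int (prefix x (Suc n)) + 1 = real (b (Suc n)) * (real_of_int (prefix x n) + 1)"
        unfolding prefix_Suc using i0(2)[of "Suc n"] step b by (simp add: algebra_simps)
      then show ?case using b step.IH by (simp add: block_prod_Suc)
    qed
    have "(\<lambda>n. real_of_int (prefix x n) / real (scale n) + 1 / real (scale n)) \<longlonglongrightarrow> x + 0"
      by (rule tendsto_add[OF prefix_div_scale inverse_scale_tendsto_0])
    then have "(\<lambda>n. (real_of_int (prefix x n) + 1) / real (scale n)) \<longlonglongrightarrow> x"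
      by (simp add: add_divide_distrib)
    moreover have "(\<lambda>n. (real_of_int (prefix x n) + 1) / real (scale n)) \<longlonglongrightarrow> c"
      by (rule tendsto_eventually) (auto simp: eventually_sequentially intro!: exI[of _ i0] c)
    ultimately have "x = c" using LIMSEQ_unique by blast
    moreover have "real (scale i0) * x < real_of_int (prefix x i0) + 1" unfolding prefix_def by linarith
    then have "x < c" unfolding c_def using scale_pos[of i0] by (simp add: field_simps)
    ultimately show False by simp
  qed
qed

text \<open>The numerators \<open>s n\<close> of the partial sums define nested cells whose left
  ends increase to \<open>x\<close> and whose right ends decrease to \<open>x\<close>. If
  \<open>x\<close> stays strictly below every right end, then \<open>s n\<close> must be the floor
  \<open>prefix x n\<close>, and the recurrence recovers the digits.\<close>

lemma is_multibase_expansion_imp_digit: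
  assumes exp: "is_multibase_expansion b x d" and x: "x \<in> {0..<1}"
  shows "d (Suc n) = digit x (Suc n)"
proof -
  have d_le: "d (Suc i) \<le> b (Suc i) - 1" for i
    using exp unfolding is_multibase_expansion_def by simp
  have sums: "(\<lambda>i. real (d (Suc i)) / real (scale (Suc i))) sums x"
    using exp unfolding is_multibase_expansion_def scale_eq by simp
  define s where "s = rec_nat (0::int) (\<lambda>n v. int (b (Suc n)) * v + int (d (Suc n)))"
  have s: "s 0 = 0" "s (Suc n) = int (b (Suc n)) * s n + int (d (Suc n))" for n
    by (simp_all add: s_def)
  have lim: "(\<lambda>n. real_of_int (s n) / real (scale n)) \<longlonglongrightarrow> x"
    using sums unfolding sums_def sum_digits_eq_of_recurrence[OF s] .
  have upper: "decseq (\<lambda>n. (real_of_int (s n) + 1) / real (scale n))"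
    and lower: "incseq (\<lambda>n. real_of_int (s n) / real (scale n))"
    and strict: "d (Suc n) < b (Suc n) - 1 \<Longrightarrow>
      (real_of_int (s (Suc n)) + 1) / real (scale (Suc n)) < (real_of_int (s n) + 1) / real (scale n)" for n
  proof -
    have b: "real (b (Suc n)) > 0" for n using base_ge_2[of "Suc n"] by simp
    have eq: "(real_of_int (s n) + 1) / real (scale n) =
      (real (b (Suc n)) * (real_of_int (s n) + 1)) / real (scale (Suc n))"
      "real_of_int (s n) / real (scale n) =
      (real (b (Suc n)) * real_of_int (s n)) / real (scale (Suc n))" for n
      using b[of n] by (simp_all add: block_prod_Suc)
    have d: "real (d (Suc n)) + 1 \<le> real (b (Suc n))" for n
      using d_le[of n] base_ge_2[of "Suc n"] by simp
    show "decseq (\<lambda>n. (real_of_int (s n) + 1) / real (scale n))"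
      unfolding decseq_Suc_iff
      by (subst eq) (use d in \<open>auto intro!: divide_right_mono simp: s algebra_simps\<close>)
    show "incseq (\<lambda>n. real_of_int (s n) / real (scale n))"
      unfolding incseq_Suc_iff
      by (subst eq) (auto intro!: divide_right_mono simp: s algebra_simps)
    show "(real_of_int (s (Suc n)) + 1) / real (scale (Suc n)) < (real_of_int (s n) + 1) / real (scale n)"
      if "d (Suc n) < b (Suc n) - 1" for n
      by (subst eq, rule divide_strict_right_mono) (use that in \<open>auto simp: s algebra_simps\<close>)
  qed
  have lim': "(\<lambda>n. (real_of_int (s n) + 1) / real (scale n)) \<longlonglongrightarrow> x"
  proof -
    have "(\<lambda>n. real_of_int (s n) / real (scale n) + 1 / real (scale n)) \<longlonglongrightarrow> x + 0"
      by (rule tendsto_add[OF lim inverse_scale_tendsto_0])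
    then show ?thesis by (simp add: add_divide_distrib)
  qed
  have s_eq: "s n = prefix x n" for n
  proof -
    have "real_of_int (s n) / real (scale n) \<le> x" using incseq_le[OF lower lim] .
    moreover have "x < (real_of_int (s n) + 1) / real (scale n)"
    proof -
      \<comment> \<open>A later non-maximal digit makes the right end drop strictly, which excludes
        equality with \<open>x\<close>.\<close>
      have "\<not> (\<forall>i\<ge>Suc n. d i = b i - 1)" using exp unfolding is_multibase_expansion_def by auto
      then obtain k where k: "k \<ge> Suc n" "d k \<noteq> b k - 1" by blast
      then obtain m where m: "m \<ge> n" "d (Suc m) \<noteq> b (Suc m) - 1" by (cases k) auto
      have "x \<le> (real_of_int (s (Suc m)) + 1) / real (scale (Suc m))" using decseq_ge[OF upper lim'] .
      also have "\<dots> < (real_of_int (s m) + 1) / real (scale m)"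
        using m(2) d_le[of m] by (intro strict) simp
      also have "\<dots> \<le> (real_of_int (s n) + 1) / real (scale n)"
        using decseqD[OF upper m(1)] .
      finally show ?thesis .
    qed
    ultimately have "\<lfloor>real (scale n) * x\<rfloor> = s n"
      using scale_pos[of n] by (intro floor_unique) (simp_all add: field_simps)
    then show ?thesis by (simp add: prefix_def)
  qed
  show ?thesis using s(2)[of n] prefix_Suc[of x n] unfolding s_eq by simp
qed

lemma multibase_digit_eq:
  assumes "x \<in> {0..<1}"
  shows "multibase_digit b x = digit x"
  unfolding multibase_digit_def
proof (rule the_equality)
  show "digit x 0 = 0 \<and> is_multibase_expansion b x (digit x)"
    using is_multibase_expansion_digit[OF assms] by (simp add: digit_def)
  fix d assume d: "d 0 = 0 \<and> is_multibase_expansion b x d"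
  show "d = digit x"
  proof
    fix n show "d n = digit x n"
      using d is_multibase_expansion_imp_digit[OF _ assms] by (cases n) (auto simp: digit_def)
  qed
qed

subsection \<open>Blocks of zero digits\<close>

lemma zero_digits_iff_prefix:
  assumes "p \<le> q"
  shows "(\<forall>k\<in>{p + 1..q}. digit x k = 0) \<longleftrightarrow> prefix x q = int (block_prod p q) * prefix x p"
proof -
  \<comment> \<open>The inequality is carried through the induction: the excess of the prefix and
    the new digit are both nonnegative, so they cancel only if both vanish.\<close>
  have "int (block_prod p q) * prefix x p \<le> prefix x q \<and>
    ((\<forall>k\<in>{p + 1..q}. digit x k = 0) \<longleftrightarrow> prefix x q = int (block_prod p q) * prefix x p)"
    using assms
  proof (induction q rule: dec_induct)
    case base
    then show ?case by simp
  next
    case (step q)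
    define u where "u = int (block_prod p q) * prefix x p"
    define v where "v = prefix x q"
    define c where "c = int (b (Suc q))"
    have c: "c > 0" using base_ge_2[of "Suc q"] by (simp add: c_def)
    have IH: "u \<le> v" "(\<forall>k\<in>{p + 1..q}. digit x k = 0) \<longleftrightarrow> v = u"
      using step.IH by (simp_all add: u_def v_def)
    have new: "int (block_prod p (Suc q)) * prefix x p = c * u"
      using step by (simp add: block_prod_Suc u_def c_def)
    have split: "{p + 1..Suc q} = insert (Suc q) {p + 1..q}" using step by auto
    have le: "c * u \<le> c * v" using IH(1) c by simp
    have "c * v + int (digit x (Suc q)) = c * u \<longleftrightarrow> digit x (Suc q) = 0 \<and> v = u"
    proof
      assume *: "c * v + int (digit x (Suc q)) = c * u"
      then have "int (digit x (Suc q)) = 0" "c * v = c * u" using le by linarith+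
      then show "digit x (Suc q) = 0 \<and> v = u" using c by simp
    qed simp
    then show ?case unfolding new prefix_Suc split c_def[symmetric] v_def[symmetric]
      using IH le by simp
  qed
  then show ?thesis by blast
qed

text \<open>Digits after position \<open>p\<close> depend only on where \<open>x\<close> lies within
  its cell of level \<open>p\<close>; zeros up to \<open>q\<close> select the leftmost subcell of
  level \<open>q\<close>.\<close>

lemma zero_digits_iff_frac:
  assumes "p \<le> q"
  shows "(\<forall>k\<in>{p + 1..q}. digit x k = 0) \<longleftrightarrow> frac (real (scale p) * x) < 1 / real (block_prod p q)"
proof -
  define y where "y = real (scale p) * x"
  define W where "W = real (block_prod p q)"
  have W: "W > 0" by (simp add: W_def)
  have q: "prefix x q = \<lfloor>W * y\<rfloor>"
    using block_prod_mult[OF le0 assms] by (simp add: prefix_def W_def y_def mult_ac flip: of_nat_mult)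
  have "W * real_of_int \<lfloor>y\<rfloor> \<le> W * y" using W by simp
  then have "\<lfloor>W * y\<rfloor> = int (block_prod p q) * \<lfloor>y\<rfloor> \<longleftrightarrow> W * y < W * real_of_int \<lfloor>y\<rfloor> + 1"
    by (simp add: floor_eq_iff W_def)
  also have "\<dots> \<longleftrightarrow> frac y < 1 / W" using W by (simp add: frac_def field_simps)
  finally show ?thesis
    unfolding zero_digits_iff_prefix[OF assms] q by (simp add: y_def W_def prefix_def)
qed

definition zero_digits :: "nat \<Rightarrow> nat \<Rightarrow> real set" where
  "zero_digits p q = {x \<in> {0..<1}. \<forall>k\<in>{p + 1..q}. digit x k = 0}"

text \<open>The choice \<open>J = UNIV\<close> brings the set into the shape measured by
  \<open>measure_floor_frac\<close>.\<close>

lemma zero_digits_eq: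
  "p \<le> q \<Longrightarrow> zero_digits p q =
    {x \<in> {0..<1}. \<lfloor>real (scale p) * x\<rfloor> \<in> UNIV \<and> frac (real (scale p) * x) < 1 / real (block_prod p q)}"
  unfolding zero_digits_def by (simp only: zero_digits_iff_frac UNIV_I simp_thms)

lemma inverse_block_prod_bounds: "0 \<le> 1 / real (block_prod p q)" "1 / real (block_prod p q) \<le> 1"
  using block_prod_pos[of p q] by (simp_all add: divide_le_eq_1 Suc_leI del: block_prod_pos)

lemma zero_digits_borel: "p \<le> q \<Longrightarrow> zero_digits p q \<in> sets borel"
  unfolding zero_digits_eq
  by (intro measure_floor_frac inverse_block_prod_bounds block_prod_pos)

lemma measure_zero_digits:
  assumes "p \<le> q"
  shows "measure lborel (zero_digits p q) = 1 / real (block_prod p q)"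
  unfolding zero_digits_eq[OF assms]
  by (subst measure_floor_frac(2)[OF block_prod_pos inverse_block_prod_bounds]) simp

lemma prefix_div_block_prod:
  assumes "k \<le> m"
  shows "prefix x k = prefix x m div int (block_prod k m)"
proof -
  have "real (scale m) * x / real_of_int (int (block_prod k m)) = real (scale k) * x"
    using block_prod_pos[of k m] by (simp flip: block_prod_mult[OF le0 assms] del: block_prod_pos)
  then show ?thesis
    unfolding prefix_def by (metis floor_divide_real_eq_div of_nat_0_le_iff)
qed

text \<open>The first event is determined by the prefix of length \<open>m\<close>, the second by
  the fractional part of \<open>scale m * x\<close>, so the measure factors.\<close>

lemma measure_zero_digits_Int:
  assumes "p \<le> q" "q \<le> m" "m \<le> l"
  shows "measure lborel (zero_digits p q \<inter> zero_digits m l) =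
    1 / real (block_prod p q) * (1 / real (block_prod m l))"
proof -
  \<comment> \<open>Integer division of the prefix at \<open>m\<close> recovers those at
    \<open>q\<close> and \<open>p\<close>, so \<open>J\<close> encodes the criterion of
    \<open>zero_digits_iff_prefix\<close>.\<close>
  define J where "J = {j. j div int (block_prod q m) = int (block_prod p q) * (j div int (block_prod p m))}"
  have J: "(\<forall>k\<in>{p + 1..q}. digit x k = 0) \<longleftrightarrow> \<lfloor>real (scale m) * x\<rfloor> \<in> J" for x
    using prefix_div_block_prod[of q m x] prefix_div_block_prod[of p m x] assms
    unfolding zero_digits_iff_prefix[OF assms(1)] J_def by (simp add: prefix_def)
  \<comment> \<open>With \<open>t = 1\<close> the same formula gives the measure of the first event,
    so the cardinality of \<open>J\<close> need not be computed.\<close>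
  have eq: "zero_digits p q = {x \<in> {0..<1}. \<lfloor>real (scale m) * x\<rfloor> \<in> J \<and> frac (real (scale m) * x) < 1}"
    unfolding zero_digits_def J by (simp add: frac_lt_1)
  have "zero_digits p q \<inter> zero_digits m l = {x \<in> {0..<1}. \<lfloor>real (scale m) * x\<rfloor> \<in> J \<and>
      frac (real (scale m) * x) < 1 / real (block_prod m l)}"
    unfolding zero_digits_def J using zero_digits_iff_frac[OF assms(3)] by auto
  then have "measure lborel (zero_digits p q \<inter> zero_digits m l) =
      real (card (J \<inter> {0..<int (scale m)})) * (1 / real (block_prod m l)) / real (scale m)"
    by (simp only: measure_floor_frac(2)[OF block_prod_pos inverse_block_prod_bounds])
  also have "\<dots> = measure lborel (zero_digits p q) * (1 / real (block_prod m l))"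
    unfolding eq by (subst measure_floor_frac(2)[OF block_prod_pos]) simp_all
  finally show ?thesis using assms by (simp add: measure_zero_digits)
qed

lemma measure_overlapping_zero_digits_le:
  assumes "p \<le> m" "m < q" "q \<le> l"
  shows "measure lborel (zero_digits p q \<inter> zero_digits m l) \<le> 1 / real (block_prod m l) / 2 ^ (m - p)"
proof -
  have "zero_digits p q \<inter> zero_digits m l = zero_digits p l"
    using assms by (auto simp: zero_digits_def)
  then have "measure lborel (zero_digits p q \<inter> zero_digits m l) = 1 / real (block_prod p m * block_prod m l)"
    using assms by (simp add: measure_zero_digits block_prod_mult del: of_nat_mult)
  also have "\<dots> = 1 / real (block_prod m l) / real (block_prod p m)" by simp
  also have "\<dots> \<le> 1 / real (block_prod m l) / 2 ^ (m - p)"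
  proof (intro divide_left_mono)
    show "2 ^ (m - p) \<le> real (block_prod p m)"
      using of_nat_mono[OF block_prod_ge[OF assms(1)], where 'a = real] by simp
  qed simp_all
  finally show ?thesis .
qed

section \<open>Block events under Lebesgue measure on the unit interval\<close>

abbreviation unit_measure :: "real measure" where
  "unit_measure \<equiv> lebesgue_on {0..<1}"

lemma prob_space_unit: "prob_space unit_measure"
  by (rule prob_spaceI) (simp add: emeasure_restrict_space)

lemma borel_subset_unit:
  assumes "A \<in> sets borel" "A \<subseteq> {0..<1}"
  shows "A \<in> sets unit_measure" "measure unit_measure A = measure lborel A"
proof -
  show "A \<in> sets unit_measure"
    using assms by (simp add: sets_restrict_space_iff sets_completionI_sets)
  show "measure unit_measure A = measure lborel A"
    using assms by (simp add: measure_restrict_space measure_completion)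
qed

definition block_event :: "(nat \<Rightarrow> nat) \<Rightarrow> nat \<Rightarrow> real set" where
  "block_event \<xi> n = zero_digits n (n + \<xi> n)"

lemma block_event_iff: "x \<in> {0..<1} \<Longrightarrow> x \<in> block_event \<xi> n \<longleftrightarrow> zero_block b \<xi> x n"
  unfolding block_event_def zero_digits_def zero_block_def by (simp add: multibase_digit_eq)

lemma block_weight_eq: "block_weight b \<xi> n = 1 / real (block_prod n (n + \<xi> n))"
  by (simp add: block_weight_def block_prod_def)

lemma block_weight_bounds: "0 \<le> block_weight b \<xi> n" "block_weight b \<xi> n \<le> 1"
  unfolding block_weight_eq by (rule inverse_block_prod_bounds)+

lemma zero_digits_subset: "zero_digits p q \<subseteq> {0..<1}"
  by (auto simp: zero_digits_def)

lemma block_event_measurable [measurable]: "block_event \<xi> n \<in> sets unit_measure"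
  unfolding block_event_def
  by (intro borel_subset_unit zero_digits_borel zero_digits_subset) simp

lemma measure_block_event: "measure unit_measure (block_event \<xi> n) = block_weight b \<xi> n"
  unfolding block_event_def block_weight_eq
  by (simp add: borel_subset_unit zero_digits_borel zero_digits_subset measure_zero_digits)

text \<open>Disjoint blocks account for the product term, overlapping ones for the geometric term.
  Monotonicity of \<open>\<xi>\<close> ensures that the later block also ends later.\<close>

lemma measure_block_event_Int_le:
  assumes "mono_on {1..} \<xi>" "1 \<le> n" "n < m"
  shows "measure unit_measure (block_event \<xi> n \<inter> block_event \<xi> m) \<le>
    block_weight b \<xi> n * block_weight b \<xi> m + block_weight b \<xi> m / 2 ^ (m - n)"
proof -
  let ?Z = "zero_digits n (n + \<xi> n) \<inter> zero_digits m (m + \<xi> m)"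
  have "\<xi> n \<le> \<xi> m" using assms by (intro mono_onD[OF assms(1)]) auto
  have "measure unit_measure ?Z = measure lborel ?Z"
    by (intro borel_subset_unit sets.Int zero_digits_borel) (use zero_digits_subset in auto)
  also have "\<dots> \<le> block_weight b \<xi> n * block_weight b \<xi> m + block_weight b \<xi> m / 2 ^ (m - n)"
  proof (cases "n + \<xi> n \<le> m")
    case True
    then show ?thesis
      using measure_zero_digits_Int[of n "n + \<xi> n" m "m + \<xi> m"] block_weight_bounds(1)[of \<xi> m]
      by (simp add: block_weight_eq)
  next
    case False
    then have "measure lborel ?Z \<le> block_weight b \<xi> m / 2 ^ (m - n)"
      unfolding block_weight_eq using \<open>n < m\<close> \<open>\<xi> n \<le> \<xi> m\<close>
      by (intro measure_overlapping_zero_digits_le) auto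
    moreover have "0 \<le> block_weight b \<xi> n * block_weight b \<xi> m"
      by (intro mult_nonneg_nonneg block_weight_bounds)
    ultimately show ?thesis by linarith
  qed
  finally show ?thesis by (simp add: block_event_def)
qed

section \<open>Almost sure counting asymptotics and the zero-one law\<close>

lemma zero_block_count_eq_sum:
  assumes "x \<in> {0..<1}"
  shows "real (zero_block_count b \<xi> x N) = (\<Sum>n=1..N. indicator (block_event \<xi> n) x)"
proof -
  have "{n \<in> {1..N}. zero_block b \<xi> x n} = {1..N} \<inter> {n. x \<in> block_event \<xi> n}"
    using block_event_iff[OF assms] by auto
  then show ?thesis
    unfolding zero_block_count_def by (simp add: indicator_def sum.If_cases)
qed

lemma count_asymp_of_not_summable:
  assumes "mono_on {1..} \<xi>" "\<not> summable (\<lambda>n. block_weight b \<xi> (Suc n))" "\<epsilon> > 0"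
  shows "AE x in unit_measure.
    (\<lambda>N. real (zero_block_count b \<xi> x N) - Phi b \<xi> N) \<in> O(Phi_error b \<xi> \<epsilon>)"
proof -
  interpret prob_space unit_measure by (rule prob_space_unit)
  have "AE x in unit_measure. (\<lambda>N. (\<Sum>n=1..N. indicator (block_event \<xi> n) x) - (\<Sum>n=1..N. block_weight b \<xi> n))
    \<in> O(\<lambda>N. (\<Sum>n=1..N. block_weight b \<xi> n) powr (1/2) *
      max 1 (ln (\<Sum>n=1..N. block_weight b \<xi> n)) powr (3/2 + \<epsilon>))"
  proof (rule AE_sum_asymp_of_variance_bound[where C = 4, OF _ _ block_weight_bounds assms(2) _ assms(3)])
    fix m n :: nat
    show "(\<integral>\<^sup>+x. ennreal ((\<Sum>k\<in>{m<..n}. indicator (block_event \<xi> k) x - block_weight b \<xi> k)\<^sup>2) \<partial>unit_measure)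
        \<le> ennreal (4 * (\<Sum>k\<in>{m<..n}. block_weight b \<xi> k))"
      unfolding measure_block_event[symmetric]
      by (rule variance_sum_indicator_le)
        (use measure_block_event_Int_le[OF assms(1)] in \<open>simp_all add: measure_block_event\<close>)
  qed (auto simp: indicator_def)
  with AE_space show ?thesis
  proof eventually_elim
    case (elim x)
    then show ?case by (simp add: zero_block_count_eq_sum Phi_def Phi_error_def[abs_def])
  qed
qed

lemma AE_finite_zero_blocks:
  assumes "summable (\<lambda>n. block_weight b \<xi> (Suc n))"
  shows "AE x in unit_measure. finite {n. zero_block b \<xi> x n}"
proof -
  interpret prob_space unit_measure by (rule prob_space_unit)
  \<comment> \<open>The series starts at index \<open>1\<close>, hence the shift; one further index
    does not affect finiteness.\<close>
  have "AE x in unit_measure. eventually (\<lambda>n. x \<in> space unit_measure - block_event \<xi> (Suc n)) sequentially"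
    using assms by (intro borel_cantelli_AE1) (auto simp: measure_block_event emeasure_eq_measure)
  with AE_space show ?thesis
  proof eventually_elim
    case (elim x)
    then have "eventually (\<lambda>n. \<not> zero_block b \<xi> x (Suc n)) sequentially"
      by (simp add: block_event_iff)
    then have "eventually (\<lambda>n. \<not> zero_block b \<xi> x n) sequentially"
      by (rule eventually_sequentially_Suc[THEN iffD1])
    then show ?case by (simp add: eventually_cofinite flip: cofinite_eq_sequentially)
  qed
qed

text \<open>Almost surely the count and \<open>Phi\<close> are both bounded, so it suffices that the
  error term stays away from \<open>0\<close>.\<close>

lemma count_asymp_of_summable:
  assumes "summable (\<lambda>n. block_weight b \<xi> (Suc n))" "\<epsilon> > 0"
  shows "AE x in unit_measure.
    (\<lambda>N. real (zero_block_count b \<xi> x N) - Phi b \<xi> N) \<in> O(Phi_error b \<xi> \<epsilon>)"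
  using AE_finite_zero_blocks[OF assms(1)]
proof eventually_elim
  case (elim x)
  define c where "c = real (card {n. zero_block b \<xi> x n})"
  define S where "S = (\<Sum>n. block_weight b \<xi> (Suc n))"
  define w where "w = block_weight b \<xi> 1 powr (1/2)"
  have w: "w > 0" by (simp add: w_def block_weight_eq)
  have count: "real (zero_block_count b \<xi> x N) \<le> c" for N
    unfolding c_def zero_block_count_def using elim by (intro of_nat_mono card_mono) auto
  have S: "Phi b \<xi> N \<le> S" for N
    unfolding Phi_def S_def One_nat_def sum.atLeast1_atMost_eq
    by (intro sum_le_suminf assms block_weight_bounds) auto
  have Phi0: "0 \<le> Phi b \<xi> N" for N
    unfolding Phi_def by (intro sum_nonneg block_weight_bounds)
  show ?case
  proof (rule bigoI[where c = "(c + S) / w"])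
    show "\<forall>\<^sub>F N in sequentially. norm (real (zero_block_count b \<xi> x N) - Phi b \<xi> N)
      \<le> (c + S) / w * norm (Phi_error b \<xi> \<epsilon> N)"
      \<comment> \<open>For \<open>N \<ge> 1\<close> the first weight is part of \<open>Phi\<close>,
        which makes \<open>w\<close> a lower bound of the error term.\<close>
      using eventually_ge_at_top[of 1]
    proof eventually_elim
      case (elim N)
      have "block_weight b \<xi> 1 \<le> Phi b \<xi> N"
        unfolding Phi_def by (rule member_le_sum) (use elim block_weight_bounds in auto)
      then have "w \<le> Phi b \<xi> N powr (1/2)"
        unfolding w_def by (intro powr_mono2 block_weight_bounds) simp_all
      moreover have "1 \<le> max 1 (ln (Phi b \<xi> N)) powr (3/2 + \<epsilon>)"
        using assms(2) by (intro ge_one_powr_ge_zero) auto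
      ultimately have "w * 1 \<le> Phi_error b \<xi> \<epsilon> N"
        unfolding Phi_error_def using w by (intro mult_mono) auto
      then have "(c + S) / w * w \<le> (c + S) / w * Phi_error b \<xi> \<epsilon> N"
        using w count[of 0] S[of 0] Phi0[of 0] by (intro mult_left_mono) auto
      moreover have "\<bar>real (zero_block_count b \<xi> x N) - Phi b \<xi> N\<bar> \<le> c + S"
        using count[of N] S[of N] Phi0[of N] by linarith
      ultimately show ?case using w by (simp add: Phi_error_def)
    qed
  qed
qed

text \<open>The error term is of smaller order than \<open>Phi\<close>, which tends to infinity. The
  count is therefore eventually at least half of \<open>Phi\<close> and cannot stay bounded.\<close>

lemma infinite_zero_blocks_of_asymp:
  assumes not_summable: "\<not> summable (\<lambda>n. block_weight b \<xi> (Suc n))"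
    and asymp: "(\<lambda>N. real (zero_block_count b \<xi> x N) - Phi b \<xi> N) \<in> O(Phi_error b \<xi> 1)"
  shows "infinite {n. zero_block b \<xi> x n}"
proof
  assume fin: "finite {n. zero_block b \<xi> x n}"
  define c where "c = real (card {n. zero_block b \<xi> x n})"
  have Phi: "filterlim (Phi b \<xi>) at_top sequentially"
    unfolding Phi_def[abs_def] by (rule partial_sums_at_top[OF block_weight_bounds(1) not_summable])
  have "(\<lambda>t::real. t powr (1/2) * max 1 (ln t) powr (3/2 + 1)) \<in> o(\<lambda>t. t)"
    by real_asymp
  from landau_o.small.compose[OF this Phi] have "Phi_error b \<xi> 1 \<in> o(Phi b \<xi>)"
    by (simp add: Phi_error_def[abs_def])
  with asymp have "(\<lambda>N. real (zero_block_count b \<xi> x N) - Phi b \<xi> N) \<in> o(Phi b \<xi>)"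
    by (rule landau_o.big_small_trans)
  then have "\<forall>\<^sub>F N in sequentially. norm (real (zero_block_count b \<xi> x N) - Phi b \<xi> N) \<le> 1/2 * norm (Phi b \<xi> N)"
    by (rule landau_o.smallD) simp
  moreover have "\<forall>\<^sub>F N in sequentially. Phi b \<xi> N > 2 * c + 1"
    using Phi by (simp add: filterlim_at_top_dense)
  ultimately have "\<forall>\<^sub>F N in sequentially. False"
  proof eventually_elim
    case (elim N)
    have "real (zero_block_count b \<xi> x N) \<le> c"
      unfolding c_def zero_block_count_def using fin by (intro of_nat_mono card_mono) auto
    moreover have "c \<ge> 0" by (simp add: c_def)
    ultimately show False using elim by simp
  qed
  then show False by simp
qed

lemma D_set_iff: "x \<in> D_set b \<xi> \<longleftrightarrow> x \<in> {0..<1} \<and> infinite {n. zero_block b \<xi> x n}"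
  by (simp add: D_set_def frequently_cofinite)

lemma D_set_measurable: "D_set b \<xi> \<in> sets unit_measure"
proof -
  \<comment> \<open>This is the limit superior of the block events.\<close>
  have "D_set b \<xi> = (\<Inter>m. \<Union>n\<in>{m..}. block_event \<xi> n)"
  proof (intro set_eqI)
    fix x
    show "x \<in> D_set b \<xi> \<longleftrightarrow> x \<in> (\<Inter>m. \<Union>n\<in>{m..}. block_event \<xi> n)"
    proof (cases "x \<in> {0..<1}")
      case True
      then show ?thesis
        by (auto simp: D_set_def INFM_nat_le block_event_iff)
    next
      case False
      then show ?thesis
        using zero_digits_subset unfolding D_set_def block_event_def by blast
    qed
  qed
  also have "\<dots> \<in> sets unit_measure" by measurable
  finally show ?thesis .
qed

end

theorem theorem3:
  fixes b :: "nat \<Rightarrow> nat" and \<xi> :: "nat \<Rightarrow> nat"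
  assumes "\<And>i. i \<ge> 1 \<Longrightarrow> b i \<ge> 2"
    and "mono_on {1..} \<xi>"
  shows "(\<forall>\<epsilon>>0. AE x in lebesgue_on {0..<1}.
            (\<lambda>N. real (zero_block_count b \<xi> x N) - Phi b \<xi> N) \<in> O(Phi_error b \<xi> \<epsilon>)) \<and>
         D_set b \<xi> \<in> sets (lebesgue_on {0..<1}) \<and>
         (summable (\<lambda>n. block_weight b \<xi> (Suc n)) \<longrightarrow>
            measure (lebesgue_on {0..<1}) (D_set b \<xi>) = 0) \<and>
         (\<not> summable (\<lambda>n. block_weight b \<xi> (Suc n)) \<longrightarrow>
            measure (lebesgue_on {0..<1}) (D_set b \<xi>) = 1)"
proof -
  interpret multibase b by unfold_locales (rule assms(1))
  interpret prob_space unit_measure by (rule prob_space_unit)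
  have asymp: "AE x in unit_measure.
      (\<lambda>N. real (zero_block_count b \<xi> x N) - Phi b \<xi> N) \<in> O(Phi_error b \<xi> \<epsilon>)" if "\<epsilon> > 0" for \<epsilon>
    using count_asymp_of_not_summable[OF assms(2) _ that] count_asymp_of_summable[OF _ that] by blast
  have "prob (D_set b \<xi>) = 0" if "summable (\<lambda>n. block_weight b \<xi> (Suc n))"
    unfolding prob_eq_0[OF D_set_measurable] using AE_finite_zero_blocks[OF that]
    by eventually_elim (simp add: D_set_iff)
  moreover have "prob (D_set b \<xi>) = 1" if "\<not> summable (\<lambda>n. block_weight b \<xi> (Suc n))"
    unfolding prob_eq_1[OF D_set_measurable]
    \<comment> \<open>A single positive value suffices here, and \<open>\<epsilon> = 1\<close> is
      taken.\<close>
    using AE_space asymp[OF zero_less_one]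
    by eventually_elim (auto simp: D_set_iff dest: infinite_zero_blocks_of_asymp[OF that])
  ultimately show ?thesis by (intro conjI allI impI asymp D_set_measurable) simp_all
qed

end
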